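(* When the physical spacetime is the Schwarzschild or Kerr spacetime, the obvious critical point $(x,y)=(0,0)$ of the energy functional $E(x,y)$ associated with the surface $S=\{t=t_0,\ r=r_0\}$ is a saddle point.
   Context: The Schwarzschild and Kerr metrics are written in the axially symmetric form \[g=F\,dt^2+2G\,dt\,d\phi+H\,d\phi^2+R^2dr^2+\Sigma^2d\theta^2,\] where $F,G,H,R,\Sigma$ are functions of $r,\theta$ only. For the Kerr spacetime, \[H\Sigma^2=\sin^2\theta\left((r^2+a^2)^2-\Delta a^2\sin^2\theta\right),\quad R^2\Delta=\Sigma^2=r^2+a^2\cos^2\theta,\quad\Delta=r^2-2mr+a^2,\] with $0<a\le m\le r$. The Schwarzschild spacetime corresponds to $a=0$ and $m>0$. For smooth functions $x,y$ of $\theta\in[0,\pi]$ with $x'(0)=x'(\pi)=y(0)=y(\pi)=0$, the (Chen-Nester-Tung) energy functional is $E(x,y)=\frac14\int_0^\pi\mathfrak B(x,y)\,d\theta$ with \[\begin{split}\mathfrak B(x,y)=&-\frac{\alpha(H\Sigma^2)_r}{2\sqrt H R^2\Sigma^2}-\sqrt H\left(\frac{H_{\theta\theta}-2l}{\beta}+\frac{R_\theta xy}{R\alpha}-\frac{xy^3\beta+H_\theta\alpha\Sigma^2}{l\alpha\beta\Sigma}\Sigma_\theta\right)\\&+\frac{\sqrt H\,y\,x_\theta}{\alpha}+\frac{\sqrt H\,y(H_\theta\alpha-xy\beta)}{l\alpha\beta}y_\theta,\end{split}\] \[\alpha=\sqrt{x^2\Sigma^2+R^2l},\qquad\beta=\sqrt{-H_\theta^2+4Hl},\qquad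 l=y^2+\Sigma^2,\] where all metric functions and their derivatives are evaluated at $r=r_0$, and subscripts $r,\theta$ denote derivatives. The pair $(0,0)$ is a solution of the Euler-Lagrange equation of $E$. The second variation is $\delta^2E_{(0,0)}(\xi,\zeta)=\frac{d^2}{d\epsilon^2}\big|_{\epsilon=0}E(\epsilon\xi,\epsilon\zeta)$; "saddle point" means a critical point at which the second variation takes both negative and positive values.
   Formalization: Added so that the energy is defined at (0,0): Δ(r0) > 0 (so R is real), and, for Kerr, -H_θ² + 4HΣ² > 0 for 0 < θ < π (so β is real and nonzero); the latter fails for example at a = m = 1, r0 = 1.1. *)

theory Defs
  imports "HOL-Analysis.Analysis"
begin

section \<open>Axially symmetric metrics and the Kerr family\<close>

text \<open>
  A metric \<open>F dt\<^sup>2 + 2 G dt d\<phi> + H d\<phi>\<^sup>2 + R\<^sup>2 dr\<^sup>2 + \<Sigma>\<^sup>2 d\<theta>\<^sup>2\<close> is given by its coefficients as functions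
  of \<open>r\<close> and \<open>\<theta>\<close>, in this order of arguments. The last two fields are \<open>R\<close> and \<open>\<Sigma>\<close> themselves,
  not their squares.
\<close>

record axisym_metric =
  mF :: "real \<Rightarrow> real \<Rightarrow> real"
  mG :: "real \<Rightarrow> real \<Rightarrow> real"
  mH :: "real \<Rightarrow> real \<Rightarrow> real"
  mR :: "real \<Rightarrow> real \<Rightarrow> real"
  mS :: "real \<Rightarrow> real \<Rightarrow> real"

definition kerr_Delta :: "real \<Rightarrow> real \<Rightarrow> real \<Rightarrow> real" where
  "kerr_Delta a m r = r\<^sup>2 - 2 * m * r + a\<^sup>2"

definition kerr_Sigma :: "real \<Rightarrow> real \<Rightarrow> real \<Rightarrow> real" where
  "kerr_Sigma a r \<theta> = sqrt (r\<^sup>2 + a\<^sup>2 * (cos \<theta>)\<^sup>2)"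

text \<open>
  The Kerr metric in Boyer-Lindquist coordinates, signature \<open>(-,+,+,+)\<close>; \<open>a = 0\<close> gives the
  Schwarzschild metric. The coefficients \<open>F\<close> and \<open>G\<close> do not enter the energy functional below.
\<close>

definition kerr :: "real \<Rightarrow> real \<Rightarrow> axisym_metric" where
  "kerr a m = \<lparr>
     mF = (\<lambda>r \<theta>. - (kerr_Delta a m r - a\<^sup>2 * (sin \<theta>)\<^sup>2) / (kerr_Sigma a r \<theta>)\<^sup>2),
     mG = (\<lambda>r \<theta>. - 2 * m * a * r * (sin \<theta>)\<^sup>2 / (kerr_Sigma a r \<theta>)\<^sup>2),
     mH = (\<lambda>r \<theta>. (sin \<theta>)\<^sup>2 * ((r\<^sup>2 + a\<^sup>2)\<^sup>2 - kerr_Delta a m r * a\<^sup>2 * (sin \<theta>)\<^sup>2)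
                   / (kerr_Sigma a r \<theta>)\<^sup>2),
     mR = (\<lambda>r \<theta>. kerr_Sigma a r \<theta> / sqrt (kerr_Delta a m r)),
     mS = (\<lambda>r \<theta>. kerr_Sigma a r \<theta>) \<rparr>"

section \<open>The Chen-Nester-Tung energy functional\<close>

definition dtheta :: "(real \<Rightarrow> real \<Rightarrow> real) \<Rightarrow> real \<Rightarrow> real \<Rightarrow> real" where
  "dtheta f r \<theta> = deriv (\<lambda>t. f r t) \<theta>"

text \<open>Derivative of a function on \<open>[0, \<pi>]\<close>, one-sided at the two poles.\<close>

definition Dpi :: "(real \<Rightarrow> real) \<Rightarrow> real \<Rightarrow> real" where
  "Dpi x \<theta> = vector_derivative x (at \<theta> within {0..pi})"

definition ell :: "axisym_metric \<Rightarrow> real \<Rightarrow> (real \<Rightarrow> real) \<Rightarrow> real \<Rightarrow> real" where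
  "ell g r0 y \<theta> = (y \<theta>)\<^sup>2 + (mS g r0 \<theta>)\<^sup>2"

definition beta_radicand :: "axisym_metric \<Rightarrow> real \<Rightarrow> (real \<Rightarrow> real) \<Rightarrow> real \<Rightarrow> real" where
  "beta_radicand g r0 y \<theta> = - (dtheta (mH g) r0 \<theta>)\<^sup>2 + 4 * mH g r0 \<theta> * ell g r0 y \<theta>"

definition cnt_alpha ::
  "axisym_metric \<Rightarrow> real \<Rightarrow> (real \<Rightarrow> real) \<Rightarrow> (real \<Rightarrow> real) \<Rightarrow> real \<Rightarrow> real" where
  "cnt_alpha g r0 x y \<theta> = sqrt ((x \<theta>)\<^sup>2 * (mS g r0 \<theta>)\<^sup>2 + (mR g r0 \<theta>)\<^sup>2 * ell g r0 y \<theta>)"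

definition cnt_beta :: "axisym_metric \<Rightarrow> real \<Rightarrow> (real \<Rightarrow> real) \<Rightarrow> real \<Rightarrow> real" where
  "cnt_beta g r0 y \<theta> = sqrt (beta_radicand g r0 y \<theta>)"

text \<open>
  At \<open>\<theta> = 0\<close> and \<open>\<theta> = \<pi>\<close>, where \<open>H\<close> and \<open>\<beta>\<close> vanish, the value of the density is immaterial for
  the integral.
\<close>

definition cnt_density ::
  "axisym_metric \<Rightarrow> real \<Rightarrow> (real \<Rightarrow> real) \<Rightarrow> (real \<Rightarrow> real) \<Rightarrow> real \<Rightarrow> real" where
  "cnt_density g r0 x y \<theta> =
    (let H = mH g r0 \<theta>; R = mR g r0 \<theta>; S = mS g r0 \<theta>;
         H\<theta> = dtheta (mH g) r0 \<theta>; H\<theta>\<theta> = dtheta (dtheta (mH g)) r0 \<theta>;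
         R\<theta> = dtheta (mR g) r0 \<theta>; S\<theta> = dtheta (mS g) r0 \<theta>;
         HSSr = deriv (\<lambda>r. mH g r \<theta> * (mS g r \<theta>)\<^sup>2) r0;
         l = ell g r0 y \<theta>; \<alpha> = cnt_alpha g r0 x y \<theta>; \<beta> = cnt_beta g r0 y \<theta>;
         X = x \<theta>; Y = y \<theta>; X\<theta> = Dpi x \<theta>; Y\<theta> = Dpi y \<theta>
     in - (\<alpha> * HSSr) / (2 * sqrt H * R\<^sup>2 * S\<^sup>2)
        - sqrt H * ((H\<theta>\<theta> - 2 * l) / \<beta> + R\<theta> * X * Y / (R * \<alpha>)
                    - (X * Y ^ 3 * \<beta> + H\<theta> * \<alpha> * S\<^sup>2) / (l * \<alpha> * \<beta> * S) * S\<theta>)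
        + sqrt H * Y * X\<theta> / \<alpha>
        + sqrt H * Y * (H\<theta> * \<alpha> - X * Y * \<beta>) / (l * \<alpha> * \<beta>) * Y\<theta>)"

definition cnt_energy ::
  "axisym_metric \<Rightarrow> real \<Rightarrow> (real \<Rightarrow> real) \<Rightarrow> (real \<Rightarrow> real) \<Rightarrow> real" where
  "cnt_energy g r0 x y = 1 / 4 * integral {0..pi} (cnt_density g r0 x y)"

section \<open>Admissible pairs, critical points and saddle points\<close>

definition smooth_on_0_pi :: "(real \<Rightarrow> real) \<Rightarrow> bool" where
  "smooth_on_0_pi f \<longleftrightarrow>
     (\<exists>D :: nat \<Rightarrow> real \<Rightarrow> real. D 0 = f \<and>
        (\<forall>n. \<forall>\<theta>\<in>{0..pi}. (D n has_real_derivative D (Suc n) \<theta>) (at \<theta> within {0..pi})))"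

definition admissible :: "(real \<Rightarrow> real) \<Rightarrow> (real \<Rightarrow> real) \<Rightarrow> bool" where
  "admissible x y \<longleftrightarrow> smooth_on_0_pi x \<and> smooth_on_0_pi y \<and>
     Dpi x 0 = 0 \<and> Dpi x pi = 0 \<and> y 0 = 0 \<and> y pi = 0"

definition energy_along ::
  "axisym_metric \<Rightarrow> real \<Rightarrow> (real \<Rightarrow> real) \<Rightarrow> (real \<Rightarrow> real) \<Rightarrow>
     (real \<Rightarrow> real) \<Rightarrow> (real \<Rightarrow> real) \<Rightarrow> real \<Rightarrow> real" where
  "energy_along g r0 x y \<xi> \<zeta> \<epsilon> =
     cnt_energy g r0 (\<lambda>\<theta>. x \<theta> + \<epsilon> * \<xi> \<theta>) (\<lambda>\<theta>. y \<theta> + \<epsilon> * \<zeta> \<theta>)"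

text \<open>
  The boundary conditions are linear and homogeneous, so variations range over the admissible pairs.
  The integrability clause excludes the default value of a divergent integral.
\<close>

definition critical_point ::
  "axisym_metric \<Rightarrow> real \<Rightarrow> (real \<Rightarrow> real) \<Rightarrow> (real \<Rightarrow> real) \<Rightarrow> bool" where
  "critical_point g r0 x y \<longleftrightarrow> admissible x y \<and>
     (\<forall>\<xi> \<zeta>. admissible \<xi> \<zeta> \<longrightarrow>
        (\<forall>\<^sub>F \<epsilon> in nhds 0.
           cnt_density g r0 (\<lambda>\<theta>. x \<theta> + \<epsilon> * \<xi> \<theta>) (\<lambda>\<theta>. y \<theta> + \<epsilon> * \<zeta> \<theta>) integrable_on {0..pi}) \<and>
        (energy_along g r0 x y \<xi> \<zeta> has_real_derivative 0) (at 0))"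

text \<open>The second variation in direction \<open>(\<xi>, \<zeta>)\<close> exists and equals \<open>v\<close>.\<close>

definition has_second_variation ::
  "axisym_metric \<Rightarrow> real \<Rightarrow> (real \<Rightarrow> real) \<Rightarrow> (real \<Rightarrow> real) \<Rightarrow>
     (real \<Rightarrow> real) \<Rightarrow> (real \<Rightarrow> real) \<Rightarrow> real \<Rightarrow> bool" where
  "has_second_variation g r0 x y \<xi> \<zeta> v \<longleftrightarrow>
     (\<exists>E'. (\<forall>\<^sub>F \<epsilon> in nhds 0. (energy_along g r0 x y \<xi> \<zeta> has_real_derivative E' \<epsilon>) (at \<epsilon>)) \<and>
           (E' has_real_derivative v) (at 0))"

definition saddle_point ::
  "axisym_metric \<Rightarrow> real \<Rightarrow> (real \<Rightarrow> real) \<Rightarrow> (real \<Rightarrow> real) \<Rightarrow> bool" where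
  "saddle_point g r0 x y \<longleftrightarrow> critical_point g r0 x y \<and>
     (\<exists>\<xi> \<zeta> v. admissible \<xi> \<zeta> \<and> has_second_variation g r0 x y \<xi> \<zeta> v \<and> v < 0) \<and>
     (\<exists>\<xi> \<zeta> v. admissible \<xi> \<zeta> \<and> has_second_variation g r0 x y \<xi> \<zeta> v \<and> 0 < v)"

end

theory Submission
  imports Defs
begin

text \<open>
  Put \<open>k = H\<^sub>\<theta> / (2 \<surd>H)\<close> and \<open>\<psi> = arccos (k / \<surd>l)\<close>, so that \<open>H\<^sub>\<theta> = 2 \<surd>(H l) cos \<psi>\<close> and
  \<open>\<beta> = 2 \<surd>(H l) sin \<psi>\<close>. The terms of the density with \<open>\<beta>\<close> in the denominator then add up to
  \<open>\<surd>(l - k\<^sup>2) - k \<psi> + (\<surd>H \<psi>)\<^sub>\<theta>\<close>; the total derivative integrates to zero, and the remainder has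
  \<open>l\<close>-derivative \<open>\<surd>(l - k\<^sup>2) / (2 l)\<close>, which stays bounded at the poles, where \<open>\<beta> = 0\<close>. Hence the
  energy along \<open>(\<epsilon> x, \<epsilon> z)\<close> is a function of \<open>w = \<epsilon>\<^sup>2\<close> that is continuously differentiable up to
  \<open>w = 0\<close>. So \<open>(0, 0)\<close> is critical, and half of the \<open>w\<close>-derivative of the integral at \<open>0\<close> is the second
  variation. It is negative along \<open>(1, 0)\<close> because \<open>(H \<Sigma>\<^sup>2)\<^sub>r > 0\<close>, and positive along
  \<open>(- cos n\<theta>, sin n\<theta>)\<close> for large \<open>n\<close>, where the cross term \<open>z x\<^sub>\<theta>\<close> dominates.
\<close>

section \<open>Derivative of the arccosine boundary term\<close>

text \<open>For \<open>l = y\<^sup>2 + S\<^sup>2\<close> one has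
  \<open>l' = 2 * (y * y' + S * S')\<close> and \<open>b\<close> = \<beta>, so the first summand of
  the derivative is the sum of the density terms with \<beta> in the denominator. The strict bound
  on \<open>(H' t)\<^sup>2\<close> keeps the argument of \<open>arccos\<close> inside (-1, 1), where
  it is differentiable.\<close>

lemma DERIV_sqrt_mult_arccos:
  fixes H H' l :: "real \<Rightarrow> real"
  assumes H: "(H has_real_derivative H' t) (at t)"
    and H': "(H' has_real_derivative H'') (at t)"
    and l: "(l has_real_derivative l') (at t)"
    and pos: "0 < H t" "0 < l t" and rad: "(H' t)\<^sup>2 < 4 * H t * l t"
  defines "b \<equiv> sqrt (4 * H t * l t - (H' t)\<^sup>2)"
  shows "((\<lambda>t. sqrt (H t) * arccos (H' t / (2 * sqrt (H t * l t)))) has_real_derivative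
     sqrt (H t) * ((2 * l t - H'') / b + H' t * l' / (2 * l t * b))
     - b / (2 * sqrt (H t)) + H' t / (2 * sqrt (H t)) * arccos (H' t / (2 * sqrt (H t * l t)))) (at t)"
proof -
  define u v where "u = sqrt (H t)" and "v = sqrt (l t)"
  define z where "z = H' t / (2 * (u * v))"
  have uv: "u > 0" "v > 0" and Hu: "H t = u\<^sup>2" and lv: "l t = v\<^sup>2"
    using pos by (auto simp: u_def v_def)
  have sq: "sqrt (H t * l t) = u * v" by (simp add: real_sqrt_mult u_def v_def)
  have b2: "b\<^sup>2 = 4 * u\<^sup>2 * v\<^sup>2 - (H' t)\<^sup>2" and b: "b > 0"
    using rad by (auto simp: b_def Hu lv)
  have "1 - z\<^sup>2 = (b / (2 * (u * v)))\<^sup>2"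
    using uv b2 by (simp add: z_def power_divide power_mult_distrib divide_simps)
  hence sz: "sqrt (1 - z\<^sup>2) = b / (2 * (u * v))" using b uv by simp
  have "z\<^sup>2 < 1" using rad uv by (simp add: z_def power_divide power_mult_distrib Hu lv)
  hence z: "-1 < z" "z < 1" unfolding abs_square_less_1 by auto
  have dz: "((\<lambda>t. H' t / (2 * sqrt (H t * l t))) has_real_derivative
      (H'' - H' t * (H' t / (2 * u\<^sup>2) + l' / (2 * v\<^sup>2))) / (2 * (u * v))) (at t)"
    using uv by (auto intro!: derivative_eq_intros H H' l simp: sq Hu lv real_sqrt_mult)
      (simp add: field_simps power2_eq_square)
  have da: "((\<lambda>t. arccos (H' t / (2 * sqrt (H t * l t)))) has_real_derivative
      inverse (- sqrt (1 - z\<^sup>2)) * ((H'' - H' t * (H' t / (2 * u\<^sup>2) + l' / (2 * v\<^sup>2))) / (2 * (u * v)))) (at t)"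
    by (rule DERIV_chain2[OF _ dz]) (use DERIV_arccos[OF z] in \<open>simp add: z_def sq\<close>)
  have du: "((\<lambda>t. sqrt (H t)) has_real_derivative H' t / (2 * u)) (at t)"
    using pos by (auto intro!: derivative_eq_intros H simp: u_def divide_simps)
  have "((\<lambda>t. sqrt (H t) * arccos (H' t / (2 * sqrt (H t * l t)))) has_real_derivative
      (H' t / (2 * u)) * arccos (H' t / (2 * sqrt (H t * l t))) +
      inverse (- sqrt (1 - z\<^sup>2)) * ((H'' - H' t * (H' t / (2 * u\<^sup>2) + l' / (2 * v\<^sup>2))) / (2 * (u * v))) * u) (at t)"
    by (rule DERIV_mult[OF du da, unfolded u_def[symmetric]])
  moreover have "inverse (- sqrt (1 - z\<^sup>2)) * ((H'' - H' t * (H' t / (2 * u\<^sup>2) + l' / (2 * v\<^sup>2))) / (2 * (u * v))) * u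
     = u * ((2 * v\<^sup>2 - H'') / b + H' t * l' / (2 * v\<^sup>2 * b)) - b / (2 * u)"
  proof -
    \<comment> \<open>This quotient stems from H in the denominator of the arccosine argument;
      eliminating \<open>(H' t)\<^sup>2\<close> through \<open>b2\<close> produces the summand
      \<open>- b / (2 * u)\<close>.\<close>
    have "(H' t)\<^sup>2 / (2 * u * b) = 2 * u * v\<^sup>2 / b - b / (2 * u)"
      using b2 uv b by (simp add: divide_simps) (simp add: algebra_simps power2_eq_square)
    moreover have "inverse (- sqrt (1 - z\<^sup>2)) * ((H'' - H' t * (H' t / (2 * u\<^sup>2) + l' / (2 * v\<^sup>2))) / (2 * (u * v))) * u
      = (H' t)\<^sup>2 / (2 * u * b) - u * (H'' - H' t * l' / (2 * v\<^sup>2)) / b"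
      unfolding sz using uv b by (simp add: field_simps power2_eq_square)
    ultimately show ?thesis using uv b by (simp add: diff_divide_distrib algebra_simps)
  qed
  ultimately show ?thesis unfolding u_def[symmetric] lv
    by (elim DERIV_cong) (simp add: lv)
qed

section \<open>Smooth functions on [0, pi] and a sine integral\<close>

text \<open>Derivatives within a nondegenerate interval are unique, so \<open>Dpi f\<close> is the
  member \<open>D 1\<close> of the tower of derivatives and inherits its continuity.\<close>

lemma smooth_on_0_piD:
  assumes "smooth_on_0_pi f"
  shows "\<And>t. t \<in> {0..pi} \<Longrightarrow> (f has_real_derivative Dpi f t) (at t within {0..pi})"
    and "continuous_on {0..pi} f" and "continuous_on {0..pi} (Dpi f)"
proof -
  obtain D where D0: "D 0 = f"
    and D: "\<And>n t. t \<in> {0..pi} \<Longrightarrow> (D n has_real_derivative D (Suc n) t) (at t within {0..pi})"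
    using assms unfolding smooth_on_0_pi_def by blast
  have eq: "Dpi f t = D 1 t" if "t \<in> {0..pi}" for t
    unfolding Dpi_def using D[OF that, of 0] that
    by (intro vector_derivative_within_closed_interval)
      (auto simp: D0 has_real_derivative_iff_has_vector_derivative)
  have cont: "continuous_on {0..pi} (D n)" for n
    using D by (rule DERIV_continuous_on)
  show "(f has_real_derivative Dpi f t) (at t within {0..pi})" if "t \<in> {0..pi}" for t
    using D[OF that, of 0] eq[OF that] by (simp add: D0)
  show "continuous_on {0..pi} f" using cont[of 0] by (simp add: D0)
  show "continuous_on {0..pi} (Dpi f)"
    using cont[of 1] continuous_on_cong[of "{0..pi}" _ "Dpi f" "D 1", OF refl eq] by blast
qed

lemma Dpi_eqI:
  assumes "(f has_real_derivative d) (at t within {0..pi})" "t \<in> {0..pi}"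
  shows "Dpi f t = d"
  unfolding Dpi_def using assms
  by (intro vector_derivative_within_closed_interval)
    (auto simp: has_real_derivative_iff_has_vector_derivative)

text \<open>One family for all test functions: \<open>n = 0\<close> yields the constants,
  \<open>d = pi / 2\<close> the cosines.\<close>

lemma smooth_on_0_pi_sinusoid: "smooth_on_0_pi (\<lambda>t. c * sin (n * t + d))"
  unfolding smooth_on_0_pi_def
\<comment> \<open>Each differentiation brings out a factor \<open>n\<close> and advances the phase
  by a quarter period.\<close>
proof (intro exI[of _ "\<lambda>k t. c * n ^ k * sin (n * t + d + real k * (pi / 2))"] conjI allI ballI)
  fix k t
  have "sin (n * t + d + real (Suc k) * (pi / 2)) = cos (n * t + d + real k * (pi / 2))"
    using sin_add[of "n * t + d + real k * (pi / 2)" "pi / 2"] by (simp add: field_simps)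
  then show "((\<lambda>t. c * n ^ k * sin (n * t + d + real k * (pi / 2))) has_real_derivative
      c * n ^ Suc k * sin (n * t + d + real (Suc k) * (pi / 2))) (at t within {0..pi})"
    by (auto intro!: derivative_eq_intros)
qed simp

text \<open>A bound uniform in \<open>n\<close> for the leading term of the second variation.
  Product-to-sum formulas give the value 1 + (1/q - 1/p)/2 with p = 2n + 1 and q = 2n - 1.\<close>

lemma integral_sin_mult_sin_power2_ge:
  assumes n: "0 < (n :: nat)"
  shows "1 \<le> integral {0..pi} (\<lambda>t. sin t * (sin (real n * t))\<^sup>2)"
proof -
  define p q where "p = 2 * real n + 1" and "q = 2 * real n - 1"
  have pq: "p > 0" "q > 0" "q \<le> p" using n by (auto simp: p_def q_def)
  define F where "F t = - cos t / 2 + cos (p * t) / (4 * p) - cos (q * t) / (4 * q)" for t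
  have dF: "(F has_real_derivative sin t * (sin (real n * t))\<^sup>2) (at t within {0..pi})" for t
  proof -
    have "sin t * (sin (real n * t))\<^sup>2 = sin t / 2 - sin t * cos (2 * (real n * t)) / 2"
      unfolding cos_double_sin by (simp add: field_simps)
    also have "\<dots> = sin t / 2 - (sin (p * t) - sin (q * t)) / 4"
      using sin_add[of "2 * real n * t" t] sin_diff[of "2 * real n * t" t]
      by (simp add: p_def q_def algebra_simps)
    finally show ?thesis unfolding F_def using pq
      by (auto intro!: derivative_eq_intros) (simp add: field_simps)
  qed
  have "((\<lambda>t. sin t * (sin (real n * t))\<^sup>2) has_integral F pi - F 0) {0..pi}"
    using dF by (intro fundamental_theorem_of_calculus)
      (auto simp: has_real_derivative_iff_has_vector_derivative)
  moreover have "F pi - F 0 \<ge> 1"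
  proof -
    have "cos (p * pi) = -1" "cos (q * pi) = -1"
      using cos_npi2[of "2 * n"] by (auto simp: p_def q_def algebra_simps cos_add cos_diff)
    moreover have "1 / p \<le> 1 / q" using pq by (intro divide_left_mono) auto
    ultimately show ?thesis by (simp add: F_def)
  qed
  ultimately show ?thesis by (simp add: integral_unique)
qed

section \<open>Geometry of the sphere\<close>

text \<open>H vanishes at the poles, so positivity is imposed on its factor \<open>h\<close>. In the
  interior \<open>radicand_pos\<close> says that the \<theta>-derivative of sqrt H is smaller in
  modulus than S, as for a surface of revolution in Euclidean space; \<open>pole\<close> excludes
  conical points.\<close>

locale embeddable_sphere =
  fixes g :: axisym_metric and r0 :: real and h h' h'' S S' R R' p :: "real \<Rightarrow> real"
  assumes mH: "\<And>t. mH g r0 t = (sin t)\<^sup>2 * h t"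
    and mS: "mS g r0 = S" and mR: "mR g r0 = R"
    and h: "\<And>t. (h has_real_derivative h' t) (at t)"
    and h': "\<And>t. (h' has_real_derivative h'' t) (at t)"
    and S: "\<And>t. (S has_real_derivative S' t) (at t)"
    and R: "\<And>t. (R has_real_derivative R' t) (at t)"
    and S'_cont: "continuous_on {0..pi} S'" and R'_cont: "continuous_on {0..pi} R'"
    and p_cont: "continuous_on {0..pi} p"
    and h_pos: "\<And>t. 0 < h t" and S_pos: "\<And>t. 0 < S t" and R_pos: "\<And>t. 0 < R t"
    and p_pos: "\<And>t. t \<in> {0<..<pi} \<Longrightarrow> 0 < p t"
    and radial: "\<And>t. t \<in> {0<..<pi} \<Longrightarrow> deriv (\<lambda>r. mH g r t * (mS g r t)\<^sup>2) r0 = (sin t)\<^sup>2 * p t"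
    and pole: "h 0 = (S 0)\<^sup>2" "h pi = (S pi)\<^sup>2"
    and radicand_pos: "\<And>t. t \<in> {0<..<pi} \<Longrightarrow> 0 < beta_radicand g r0 (\<lambda>_. 0) t"
begin

definition H' where "H' t = sin t * (2 * cos t * h t + sin t * h' t)"

definition H'' where "H'' t = cos t * (2 * cos t * h t + sin t * h' t)
  + sin t * (- 2 * sin t * h t + 3 * cos t * h' t + sin t * h'' t)"

text \<open>Equals \<open>H\<^sub>\<theta> / (2 \<surd>H)\<close>, with the common factor \<open>sin \<theta>\<close> cancelled.\<close>

definition k where "k t = (2 * cos t * h t + sin t * h' t) / (2 * sqrt (h t))"

lemma H'_eq: "H' t = 2 * sin t * sqrt (h t) * k t"
  using h_pos[of t] by (simp add: k_def H'_def)

lemma DERIV_H: "((\<lambda>t. (sin t)\<^sup>2 * h t) has_real_derivative H' t) (at t)"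
  unfolding H'_def by (auto intro!: derivative_eq_intros h simp: algebra_simps power2_eq_square)

lemma DERIV_H': "(H' has_real_derivative H'' t) (at t)"
  unfolding H'_def[abs_def] H''_def by (auto intro!: derivative_eq_intros h h' simp: algebra_simps)

lemma dtheta_mH: "dtheta (mH g) r0 = H'"
  using DERIV_H by (auto simp: dtheta_def mH fun_eq_iff intro: DERIV_imp_deriv)

lemma dtheta_dtheta_mH: "dtheta (dtheta (mH g)) r0 t = H'' t"
  using DERIV_H' by (auto simp: dtheta_def[of "dtheta (mH g)"] dtheta_mH intro: DERIV_imp_deriv)

lemma dtheta_mS: "dtheta (mS g) r0 t = S' t"
  using S by (auto simp: dtheta_def mS intro: DERIV_imp_deriv)

lemma dtheta_mR: "dtheta (mR g) r0 t = R' t"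
  using R by (auto simp: dtheta_def mR intro: DERIV_imp_deriv)

lemma k_less: "t \<in> {0<..<pi} \<Longrightarrow> (k t)\<^sup>2 < (S t)\<^sup>2"
proof -
  assume t: "t \<in> {0<..<pi}"
  have "(H' t)\<^sup>2 < 4 * ((sin t)\<^sup>2 * h t) * (S t)\<^sup>2"
    using radicand_pos[OF t] by (simp add: beta_radicand_def dtheta_mH mH ell_def mS)
  moreover have "(H' t)\<^sup>2 = 4 * ((sin t)\<^sup>2 * h t) * (k t)\<^sup>2"
    using h_pos[of t] by (simp add: H'_eq power_mult_distrib)
  ultimately show ?thesis
    using h_pos[of t] by (simp add: mult_less_cancel_left split: if_splits)
qed

text \<open>At a pole sin vanishes, so \<open>k\<close> is sqrt h up to sign, and
  \<open>pole\<close> identifies h with the square of S. Here the arccosine argument of the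
  unperturbed sphere reaches 1 or -1.\<close>

lemma k_poles: "(k 0)\<^sup>2 = (S 0)\<^sup>2" "(k pi)\<^sup>2 = (S pi)\<^sup>2"
  using h_pos[of 0] h_pos[of pi] pole
  by (auto simp: k_def power_divide power_mult_distrib power2_eq_square[of "_ ^ 2"] field_simps)

lemma k_le: "t \<in> {0..pi} \<Longrightarrow> (k t)\<^sup>2 \<le> (S t)\<^sup>2"
  using k_less[of t] k_poles by (cases "t = 0 \<or> t = pi") (auto simp: less_le)

lemma cont [continuous_intros]:
  "continuous_on A h" "continuous_on A h'" "continuous_on A S" "continuous_on A R"
  using h h' S R by (auto intro!: continuous_at_imp_continuous_on DERIV_isCont)

lemma k_cont [continuous_intros]: "continuous_on A k"
  unfolding k_def[abs_def] using h_pos by (intro continuous_intros) (auto simp: less_imp_neq[symmetric])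

section \<open>The reduced density as a function of w\<close>

text \<open>With w the square of e, \<open>L\<close> and \<open>alpha\<close> are \<open>ell\<close>
  and \<open>cnt_alpha\<close> along the ray (e x, e z).\<close>

definition L where "L z w t = (S t)\<^sup>2 + w * (z t)\<^sup>2"

definition alpha where "alpha x z w t = sqrt (w * (x t)\<^sup>2 * (S t)\<^sup>2 + (R t)\<^sup>2 * L z w t)"

text \<open>The prime is the derivative in \<open>w\<close>, not in \<theta>.\<close>

definition alpha' where "alpha' x z w t = ((x t)\<^sup>2 * (S t)\<^sup>2 + (R t)\<^sup>2 * (z t)\<^sup>2) / (2 * alpha x z w t)"

text \<open>\<open>C\<close> carries the radial derivative of \<open>H * S\<^sup>2\<close>, one
  factor sin being cancelled against sqrt H. \<open>P\<close> and \<open>Q\<close> collect the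
  numerators of second and fourth order in e.\<close>

definition C where "C t = sin t * p t / (2 * sqrt (h t) * (R t)\<^sup>2 * (S t)\<^sup>2)"

definition P where "P x z t = sqrt (h t) * sin t * (z t * Dpi x t - R' t * x t * z t / R t)"

definition Q where
  "Q x z t = sqrt (h t) * sin t * (x t * (z t) ^ 3 * S' t / S t - x t * (z t)\<^sup>2 * Dpi z t)"

text \<open>The density along \<open>(\<epsilon> x, \<epsilon> z)\<close> after the partial integration, as a function of \<open>w = \<epsilon>\<^sup>2\<close>.\<close>

definition Phi where
  "Phi x z w t = - C t * alpha x z w t + w * P x z t / alpha x z w t
     + w\<^sup>2 * Q x z t / (alpha x z w t * L z w t)
     + (sqrt (L z w t - (k t)\<^sup>2) - k t * arccos (k t / sqrt (L z w t)))"

text \<open>The derivative of \<open>Phi\<close> in \<open>w\<close>, summand by summand. In the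
  last one the singularities of the square root and of the arccosine have cancelled.\<close>

definition Psi where
  "Psi x z w t = - C t * alpha' x z w t
     + (P x z t / alpha x z w t - w * P x z t * alpha' x z w t / (alpha x z w t)\<^sup>2)
     + (2 * w * Q x z t / (alpha x z w t * L z w t)
        - w\<^sup>2 * Q x z t * (alpha' x z w t * L z w t + alpha x z w t * (z t)\<^sup>2) / (alpha x z w t * L z w t)\<^sup>2)
     + (z t)\<^sup>2 * sqrt (L z w t - (k t)\<^sup>2) / (2 * L z w t)"

lemma L_pos: "0 \<le> w \<Longrightarrow> 0 < L z w t"
  using S_pos[of t] by (simp add: L_def add_pos_nonneg)

lemma alpha_pos: "0 \<le> w \<Longrightarrow> 0 < alpha x z w t"
  using L_pos[of w z t] R_pos[of t] by (simp add: alpha_def add_nonneg_pos)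

lemma L_ge: "t \<in> {0..pi} \<Longrightarrow> 0 \<le> w \<Longrightarrow> (k t)\<^sup>2 \<le> L z w t"
  using k_le[of t] by (simp add: L_def add_increasing2)

lemma L_gt: "t \<in> {0<..<pi} \<Longrightarrow> 0 \<le> w \<Longrightarrow> (k t)\<^sup>2 < L z w t"
  using k_less[of t] by (auto simp: L_def intro: less_le_trans)

lemma arccos_arg:
  assumes "t \<in> {0..pi}" "0 \<le> w"
  shows "-1 \<le> k t / sqrt (L z w t)" "k t / sqrt (L z w t) \<le> 1"
proof -
  have "\<bar>k t\<bar> \<le> sqrt (L z w t)" using L_ge[OF assms] real_le_rsqrt by (metis power2_abs)
  then show "-1 \<le> k t / sqrt (L z w t)" "k t / sqrt (L z w t) \<le> 1"
    using L_pos[OF assms(2), of z t] by (auto simp: divide_simps)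
qed

text \<open>The partial integration: \<open>DERIV_sqrt_mult_arccos\<close> absorbs the \<beta>
  terms. All others contain x, y and their derivatives in even total degree, so only the square of e
  remains.\<close>

lemma density_Phi:
  fixes x z :: "real \<Rightarrow> real" and e :: real
  assumes adm: "admissible x z" and t: "t \<in> {0<..<pi}"
  shows "((\<lambda>t. sqrt ((sin t)\<^sup>2 * h t) * arccos (k t / sqrt (L z (e\<^sup>2) t))) has_real_derivative
    cnt_density g r0 (\<lambda>t. 0 + e * x t) (\<lambda>t. 0 + e * z t) t - Phi x z (e\<^sup>2) t) (at t)"
proof -
  have tt: "t \<in> {0..pi}" and st: "sin t > 0" using t by (auto intro: sin_gt_zero)
  have xd: "(x has_real_derivative Dpi x t) (at t within {0..pi})"
    and zd: "(z has_real_derivative Dpi z t) (at t within {0..pi})"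
    using adm smooth_on_0_piD(1)[OF _ tt] by (auto simp: admissible_def)
  have Dx: "Dpi (\<lambda>t. 0 + e * x t) t = e * Dpi x t" and Dz: "Dpi (\<lambda>t. 0 + e * z t) t = e * Dpi z t"
    by (rule Dpi_eqI[OF _ tt]; auto intro!: derivative_eq_intros xd zd)+
  have zat: "(z has_real_derivative Dpi z t) (at t)"
    using zd t at_within_interior[of t "{0..pi}"] by (simp add: interior_atLeastAtMost_real)
  have Ld: "(L z (e\<^sup>2) has_real_derivative 2 * S t * S' t + 2 * e\<^sup>2 * z t * Dpi z t) (at t)"
    unfolding L_def[abs_def] by (auto intro!: derivative_eq_intros S zat)
  define l a s \<eta> where "l = L z (e\<^sup>2) t" and "a = alpha x z (e\<^sup>2) t" and "s = sin t" and "\<eta> = sqrt (h t)"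
  define b where "b = sqrt (l - (k t)\<^sup>2)"
  have pos: "l > 0" "a > 0" "s > 0" "\<eta> > 0" "b > 0" "S t > 0" "R t > 0"
    using L_pos[of "e\<^sup>2"] alpha_pos[of "e\<^sup>2"] st h_pos L_gt[OF t, of "e\<^sup>2"] S_pos R_pos
    by (auto simp: l_def a_def s_def \<eta>_def b_def)
  have \<eta>2: "h t = \<eta>\<^sup>2" using h_pos[of t] by (simp add: \<eta>_def)
  have b2: "b\<^sup>2 = l - (k t)\<^sup>2" using L_ge[OF tt, of "e\<^sup>2"] by (simp add: b_def l_def)
  have sH: "sqrt ((sin t)\<^sup>2 * h t) = s * \<eta>"
    using pos by (simp add: real_sqrt_mult s_def \<eta>_def)
  have rad: "4 * ((sin t)\<^sup>2 * h t) * l - (H' t)\<^sup>2 = (2 * s * \<eta> * b)\<^sup>2"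
    unfolding H'_eq power_mult_distrib b2 by (simp add: \<eta>_def[symmetric] s_def[symmetric] \<eta>2 algebra_simps)
  moreover have "0 < (2 * s * \<eta> * b)\<^sup>2"
    using pos by (intro zero_less_power mult_pos_pos) auto
  ultimately have rad_less: "(H' t)\<^sup>2 < 4 * ((sin t)\<^sup>2 * h t) * l"
    by linarith
  \<comment> \<open>The factor sin cancels only where it is positive; agreement on this open
    interval suffices for a derivative at \<open>t\<close>.\<close>
  have arg: "H' u / (2 * sqrt ((sin u)\<^sup>2 * h u * L z (e\<^sup>2) u)) = k u / sqrt (L z (e\<^sup>2) u)"
    if "u \<in> {0<..<pi}" for u
    using sin_gt_zero[of u] h_pos[of u] that L_pos[of "e\<^sup>2" z u] by (simp add: H'_eq real_sqrt_mult)
  have "((\<lambda>t. sqrt ((sin t)\<^sup>2 * h t) * arccos (H' t / (2 * sqrt ((sin t)\<^sup>2 * h t * L z (e\<^sup>2) t)))) has_real_derivative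
     s * \<eta> * ((2 * l - H'' t) / (2 * s * \<eta> * b)
       + H' t * (2 * S t * S' t + 2 * e\<^sup>2 * z t * Dpi z t) / (2 * l * (2 * s * \<eta> * b)))
     - 2 * s * \<eta> * b / (2 * (s * \<eta>)) + H' t / (2 * (s * \<eta>)) * arccos (k t / sqrt l)) (at t)"
    using DERIV_sqrt_mult_arccos[OF DERIV_H DERIV_H' Ld] rad rad_less pos arg[OF t] h_pos[of t] st
    by (simp add: l_def[symmetric] sH)
  also have "?this \<longleftrightarrow> ((\<lambda>t. sqrt ((sin t)\<^sup>2 * h t) * arccos (k t / sqrt (L z (e\<^sup>2) t))) has_real_derivative
     s * \<eta> * ((2 * l - H'' t) / (2 * s * \<eta> * b)
       + H' t * (2 * S t * S' t + 2 * e\<^sup>2 * z t * Dpi z t) / (2 * l * (2 * s * \<eta> * b)))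
     - 2 * s * \<eta> * b / (2 * (s * \<eta>)) + H' t / (2 * (s * \<eta>)) * arccos (k t / sqrt l)) (at t)"
    by (rule DERIV_cong_ev) (use eventually_nhds_in_open[of "{0<..<pi}" t] t arg in \<open>auto elim!: eventually_mono\<close>)
  finally show ?thesis
  proof (rule DERIV_cong)
    have ell: "ell g r0 (\<lambda>t. 0 + e * z t) t = l"
      by (simp add: ell_def mS l_def L_def power_mult_distrib)
    have al: "cnt_alpha g r0 (\<lambda>t. 0 + e * x t) (\<lambda>t. 0 + e * z t) t = a"
      by (simp add: cnt_alpha_def ell[simplified] mS mR a_def alpha_def l_def power_mult_distrib)
    have be: "cnt_beta g r0 (\<lambda>t. 0 + e * z t) t = 2 * s * \<eta> * b"
      using rad pos ell by (simp add: cnt_beta_def beta_radicand_def dtheta_mH mH)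
    have dens: "cnt_density g r0 (\<lambda>t. 0 + e * x t) (\<lambda>t. 0 + e * z t) t =
      - (a * (s\<^sup>2 * p t)) / (2 * (s * \<eta>) * (R t)\<^sup>2 * (S t)\<^sup>2)
        - s * \<eta> * ((H'' t - 2 * l) / (2 * s * \<eta> * b) + R' t * (e * x t) * (e * z t) / (R t * a)
                    - ((e * x t) * (e * z t) ^ 3 * (2 * s * \<eta> * b) + H' t * a * (S t)\<^sup>2) / (l * a * (2 * s * \<eta> * b) * S t) * S' t)
        + s * \<eta> * (e * z t) * (e * Dpi x t) / a
        + s * \<eta> * (e * z t) * (H' t * a - (e * x t) * (e * z t) * (2 * s * \<eta> * b)) / (l * a * (2 * s * \<eta> * b)) * (e * Dpi z t)"
      unfolding cnt_density_def Let_def ell al be Dx Dz dtheta_dtheta_mH dtheta_mH dtheta_mR dtheta_mS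
        radial[OF t] mH mS mR s_def[symmetric] sH[folded s_def]
      by (simp only: add_0)
    have Phi: "Phi x z (e\<^sup>2) t = - (s * p t / (2 * \<eta> * (R t)\<^sup>2 * (S t)\<^sup>2)) * a
      + e\<^sup>2 * (\<eta> * s * (z t * Dpi x t - R' t * x t * z t / R t)) / a
      + (e\<^sup>2)\<^sup>2 * (\<eta> * s * (x t * (z t) ^ 3 * S' t / S t - x t * (z t)\<^sup>2 * Dpi z t)) / (a * l)
      + (b - k t * arccos (k t / sqrt l))"
      unfolding Phi_def C_def P_def Q_def a_def[symmetric] l_def[symmetric] b_def[symmetric]
        s_def[symmetric] \<eta>_def[symmetric] ..
    show "s * \<eta> * ((2 * l - H'' t) / (2 * s * \<eta> * b)
       + H' t * (2 * S t * S' t + 2 * e\<^sup>2 * z t * Dpi z t) / (2 * l * (2 * s * \<eta> * b)))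
     - 2 * s * \<eta> * b / (2 * (s * \<eta>)) + H' t / (2 * (s * \<eta>)) * arccos (k t / sqrt l)
     = cnt_density g r0 (\<lambda>t. 0 + e * x t) (\<lambda>t. 0 + e * z t) t - Phi x z (e\<^sup>2) t"
      unfolding dens Phi H'_eq s_def[symmetric] \<eta>_def[symmetric] using pos
      by (simp add: field_simps power2_eq_square power3_eq_cube)
  qed
qed

text \<open>In the interior the root and the arccosine together give
  \<open>(z t)\<^sup>2 / (2 * b) * (1 - (k t)\<^sup>2 / L z w t)\<close> with
  \<open>b\<^sup>2 = L z w t - (k t)\<^sup>2\<close>, which removes \<open>b\<close> from the
  denominator.\<close>

lemma DERIV_Phi:
  assumes "z 0 = 0" "z pi = 0" and t: "t \<in> {0..pi}" and w: "0 \<le> w"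
  shows "((\<lambda>w. Phi x z w t) has_real_derivative Psi x z w t) (at w)"
proof -
  note pos = L_pos[OF w, of z t] alpha_pos[OF w, of x z t]
  have dL: "((\<lambda>w. L z w t) has_real_derivative (z t)\<^sup>2) (at w)"
    unfolding L_def by (auto intro!: derivative_eq_intros)
  have dA: "((\<lambda>w. alpha x z w t) has_real_derivative alpha' x z w t) (at w)"
    unfolding alpha_def[abs_def] alpha'_def using pos
    by (auto intro!: derivative_eq_intros dL simp: alpha_def divide_simps)
  have d1: "((\<lambda>w. - C t * alpha x z w t) has_real_derivative - C t * alpha' x z w t) (at w)"
    by (auto intro!: derivative_eq_intros dA)
  have d2: "((\<lambda>w. w * P x z t / alpha x z w t) has_real_derivative
      P x z t / alpha x z w t - w * P x z t * alpha' x z w t / (alpha x z w t)\<^sup>2) (at w)"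
    using pos by (auto intro!: derivative_eq_intros dA simp: field_simps power2_eq_square)
  have d3: "((\<lambda>w. w\<^sup>2 * Q x z t / (alpha x z w t * L z w t)) has_real_derivative
      2 * w * Q x z t / (alpha x z w t * L z w t)
        - w\<^sup>2 * Q x z t * (alpha' x z w t * L z w t + alpha x z w t * (z t)\<^sup>2) / (alpha x z w t * L z w t)\<^sup>2) (at w)"
    using pos by (auto intro!: derivative_eq_intros dA dL)
      (simp add: field_simps power2_eq_square)
  have d4: "((\<lambda>w. sqrt (L z w t - (k t)\<^sup>2) - k t * arccos (k t / sqrt (L z w t))) has_real_derivative
      (z t)\<^sup>2 * sqrt (L z w t - (k t)\<^sup>2) / (2 * L z w t)) (at w)"
  proof (cases "t \<in> {0<..<pi}")
    \<comment> \<open>At a pole \<open>arccos\<close> is taken at 1 or -1, where it has no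
      derivative; but \<open>z\<close> vanishes there, so the expression is constant in
      \<open>w\<close>.\<close>
    case False
    then have "z t = 0" using assms by (cases "t = 0") auto
    then show ?thesis by (simp add: L_def)
  next
    case True
    define v b where "v = sqrt (L z w t)" and "b = sqrt (L z w t - (k t)\<^sup>2)"
    have vb: "v > 0" "b > 0" and Lv: "L z w t = v\<^sup>2" and b2: "b\<^sup>2 = v\<^sup>2 - (k t)\<^sup>2"
      using pos L_gt[OF True w, of z] by (auto simp: v_def b_def)
    have "1 - (k t / v)\<^sup>2 = (b / v)\<^sup>2" using vb b2 by (simp add: power_divide divide_simps)
    then have sz: "sqrt (1 - (k t / v)\<^sup>2) = b / v" using vb by simp
    have "(k t / v)\<^sup>2 < 1" using L_gt[OF True w, of z] vb by (simp add: power_divide Lv)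
    then have "\<bar>k t / v\<bar> < 1" unfolding abs_square_less_1 .
    then have "-1 < k t / v" "k t / v < 1" unfolding abs_less_iff by linarith+
    from DERIV_arccos[OF this]
    have da: "(arccos has_real_derivative - (v / b)) (at (k t / sqrt (L z w t)))"
      by (simp add: v_def[symmetric] sz)
    have ds: "((\<lambda>w. k t / sqrt (L z w t)) has_real_derivative - k t * (z t)\<^sup>2 / (2 * v ^ 3)) (at w)"
      using vb pos by (auto intro!: derivative_eq_intros dL simp: v_def[symmetric])
        (simp add: field_simps power2_eq_square power3_eq_cube Lv)
    have db: "((\<lambda>w. sqrt (L z w t - (k t)\<^sup>2)) has_real_derivative (z t)\<^sup>2 / (2 * b)) (at w)"
      using vb L_gt[OF True w, of z]
      by (auto intro!: derivative_eq_intros dL simp: b_def divide_simps)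
    have "((\<lambda>w. sqrt (L z w t - (k t)\<^sup>2) - k t * arccos (k t / sqrt (L z w t))) has_real_derivative
      (z t)\<^sup>2 / (2 * b) - k t * (- (v / b) * (- k t * (z t)\<^sup>2 / (2 * v ^ 3)))) (at w)"
      by (intro DERIV_diff db DERIV_cmult DERIV_chain2[OF da ds])
    moreover have "(z t)\<^sup>2 / (2 * b) - k t * (- (v / b) * (- k t * (z t)\<^sup>2 / (2 * v ^ 3)))
        = (z t)\<^sup>2 * (v\<^sup>2 - (k t)\<^sup>2) / (2 * b * v\<^sup>2)"
      using vb by (simp add: field_simps power2_eq_square power3_eq_cube)
    ultimately show ?thesis using vb
      unfolding b2[symmetric] b_def[symmetric] Lv
      by (elim DERIV_cong) (simp add: power2_eq_square)
  qed
  show ?thesis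
    unfolding Phi_def Psi_def by (intro DERIV_add d1 d2 d3 d4)
qed

lemma continuous_on_Phi:
  assumes [continuous_intros]: "continuous_on {0..pi} x" "continuous_on {0..pi} z"
    "continuous_on {0..pi} (Dpi x)" "continuous_on {0..pi} (Dpi z)" and w: "0 \<le> w"
  shows "continuous_on {0..pi} (Phi x z w)"
proof -
  note [continuous_intros] = S'_cont R'_cont p_cont
  have nz: "h t > 0" "S t \<noteq> 0" "R t \<noteq> 0" "sqrt (L z w t) \<noteq> 0" "alpha x z w t \<noteq> 0" "L z w t \<noteq> 0" for t
    using h_pos[of t] S_pos[of t] R_pos[of t] L_pos[OF w, of z t] alpha_pos[OF w, of x z t] by auto
  have nh: "h t \<noteq> 0" for t using h_pos[of t] by simp
  have cL [continuous_intros]: "continuous_on {0..pi} (L z w)"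
    unfolding L_def[abs_def] by (intro continuous_intros)
  have cA [continuous_intros]: "continuous_on {0..pi} (alpha x z w)"
    unfolding alpha_def[abs_def] by (intro continuous_intros)
  show ?thesis
    unfolding Phi_def[abs_def] C_def P_def Q_def
    using arccos_arg[OF _ w, of _ z] nz nh by (intro continuous_intros) auto
qed

text \<open>All denominators stay positive up to w = 0 and the poles. Joint continuity permits
  differentiation under the integral and makes the result continuous in \<open>w\<close>.\<close>

lemma continuous_on_Psi:
  assumes "continuous_on {0..pi} x" "continuous_on {0..pi} z"
    "continuous_on {0..pi} (Dpi x)" "continuous_on {0..pi} (Dpi z)"
  shows "continuous_on ({0..} \<times> {0..pi}) (\<lambda>(w, t). Psi x z w t)"
proof -
  let ?U = "{0..} \<times> {0..pi} :: (real \<times> real) set"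
  have snd: "continuous_on ?U (\<lambda>u. f (snd u))" if "continuous_on {0..pi} f" for f :: "real \<Rightarrow> real"
    by (rule continuous_on_compose2[OF that continuous_on_snd[OF continuous_on_id]]) auto
  note [continuous_intros] = S'_cont[THEN snd] R'_cont[THEN snd] p_cont[THEN snd]
    assms[THEN snd] cont[THEN snd] k_cont[THEN snd]
  have nz: "h t \<noteq> 0" "S t \<noteq> 0" "R t \<noteq> 0" for t
    using h_pos[of t] S_pos[of t] R_pos[of t] by auto
  have nz': "alpha x z w t \<noteq> 0" "L z w t \<noteq> 0" if "(w, t) \<in> ?U" for t w
    using that L_pos[of w z t] alpha_pos[of w x z t] by auto
  have cL [continuous_intros]: "continuous_on ?U (\<lambda>u. L z (fst u) (snd u))"
    unfolding L_def[abs_def] by (intro continuous_intros)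
  have cA [continuous_intros]: "continuous_on ?U (\<lambda>u. alpha x z (fst u) (snd u))"
    unfolding alpha_def[abs_def] by (intro continuous_intros)
  have cA' [continuous_intros]: "continuous_on ?U (\<lambda>u. alpha' x z (fst u) (snd u))"
    unfolding alpha'_def[abs_def] using nz' by (intro continuous_intros) auto
  show ?thesis
    unfolding Psi_def[abs_def] C_def P_def Q_def split_beta
    using nz nz' by (intro continuous_intros) auto
qed

section \<open>First and second variation of the energy\<close>

lemma admissible_cont:
  assumes "admissible x z"
  shows "continuous_on {0..pi} x" "continuous_on {0..pi} z"
    "continuous_on {0..pi} (Dpi x)" "continuous_on {0..pi} (Dpi z)" "z 0 = 0" "z pi = 0"
  using assms smooth_on_0_piD(2,3) by (auto simp: admissible_def)

text \<open>The boundary term vanishes because sqrt H is zero at both poles. Its derivative is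
  required only in the interior, given continuity on the closed interval.\<close>

lemma density_has_integral:
  assumes adm: "admissible x z"
  shows "(cnt_density g r0 (\<lambda>t. 0 + e * x t) (\<lambda>t. 0 + e * z t) has_integral
    integral {0..pi} (Phi x z (e\<^sup>2))) {0..pi}"
proof -
  note c = admissible_cont[OF adm]
  let ?d = "cnt_density g r0 (\<lambda>t. 0 + e * x t) (\<lambda>t. 0 + e * z t)"
  let ?F = "\<lambda>t. sqrt ((sin t)\<^sup>2 * h t) * arccos (k t / sqrt (L z (e\<^sup>2) t))"
  have "sqrt (L z (e\<^sup>2) t) \<noteq> 0" for t using L_pos[of "e\<^sup>2" z t] by auto
  then have "continuous_on {0..pi} ?F"
    using arccos_arg[of _ "e\<^sup>2" z] unfolding L_def by (intro continuous_intros c) auto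
  then have "((\<lambda>t. ?d t - Phi x z (e\<^sup>2) t) has_integral ?F pi - ?F 0) {0..pi}"
    using density_Phi[OF adm]
    by (intro fundamental_theorem_of_calculus_interior)
      (auto simp: has_real_derivative_iff_has_vector_derivative[symmetric])
  from has_integral_add[OF this integrable_integral[of "Phi x z (e\<^sup>2)"]] show ?thesis
    using continuous_on_Phi[OF c(1-4), of "e\<^sup>2"] by (simp add: integrable_continuous_real)
qed

lemma energy_along_eq:
  "admissible x z \<Longrightarrow>
    energy_along g r0 (\<lambda>_. 0) (\<lambda>_. 0) x z e = 1 / 4 * integral {0..pi} (Phi x z (e\<^sup>2))"
  using integral_unique[OF density_has_integral] by (simp only: energy_along_def cnt_energy_def)

lemma DERIV_energy_along:
  assumes adm: "admissible x z"
  shows "(energy_along g r0 (\<lambda>_. 0) (\<lambda>_. 0) x z has_real_derivative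
    e * (integral {0..pi} (Psi x z (e\<^sup>2)) / 2)) (at e)"
proof -
  note c = admissible_cont[OF adm]
  have "((\<lambda>w. integral (cbox 0 pi) (Phi x z w)) has_real_derivative
      integral (cbox 0 pi) (Psi x z (e\<^sup>2))) (at (e\<^sup>2) within {0..})"
    using continuous_on_Psi[OF c(1-4)] continuous_on_Phi[OF c(1-4)]
    by (intro leibniz_rule_field_derivative has_field_derivative_at_within[OF DERIV_Phi]
        integrable_continuous_real) (auto intro: integrable_continuous_real simp: c)
  \<comment> \<open>At e = 0 the parameter w is at the endpoint of its range, so the derivative is
    taken within the set of squares, as the chain rule asks.\<close>
  then have "((\<lambda>w. integral {0..pi} (Phi x z w)) has_real_derivative
      integral {0..pi} (Psi x z (e\<^sup>2))) (at (e\<^sup>2) within range power2)"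
    by (auto intro: DERIV_subset)
  moreover have "(power2 has_real_derivative 2 * e) (at e)"
    by (auto intro!: derivative_eq_intros)
  ultimately have "((\<lambda>e. integral {0..pi} (Phi x z (e\<^sup>2))) has_real_derivative
      integral {0..pi} (Psi x z (e\<^sup>2)) * (2 * e)) (at e)"
    using DERIV_image_chain[of "\<lambda>w. integral {0..pi} (Phi x z w)" _ power2 e UNIV "2 * e"]
    by (simp add: comp_def)
  then have "((\<lambda>e. 1 / 4 * integral {0..pi} (Phi x z (e\<^sup>2))) has_real_derivative
      1 / 4 * (integral {0..pi} (Psi x z (e\<^sup>2)) * (2 * e))) (at e)"
    by (rule DERIV_cmult)
  then show ?thesis
    unfolding energy_along_eq[OF adm, abs_def] by (rule DERIV_cong) simp
qed

text \<open>The first derivative is \<open>e * (?J (e\<^sup>2) / 2)\<close>, and continuity of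
  \<open>?J\<close> turns this factorization into its derivative at 0 by Caratheodory's
  criterion.\<close>

lemma second_variation:
  assumes adm: "admissible x z"
  shows "has_second_variation g r0 (\<lambda>_. 0) (\<lambda>_. 0) x z (integral {0..pi} (Psi x z 0) / 2)"
proof -
  let ?J = "\<lambda>w. integral {0..pi} (Psi x z w)"
  have "continuous_on {0..} ?J"
    using integral_continuous_on_param[of "{0..}" 0 pi "Psi x z"]
      continuous_on_Psi[OF admissible_cont(1-4)[OF adm]] by simp
  then have "continuous_on UNIV (\<lambda>e. ?J (e\<^sup>2))"
    by (rule continuous_on_compose2) (auto intro: continuous_intros)
  then have "isCont (\<lambda>e. ?J (e\<^sup>2) / 2) 0"
    by (auto simp: continuous_on_eq_continuous_at intro!: continuous_intros)
  then have "((\<lambda>e. e * (?J (e\<^sup>2) / 2)) has_real_derivative ?J 0 / 2) (at 0)"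
    unfolding CARAT_DERIV by (intro exI[of _ "\<lambda>e. ?J (e\<^sup>2) / 2"]) auto
  then show ?thesis
    unfolding has_second_variation_def
    by (intro exI[of _ "\<lambda>e. e * (?J (e\<^sup>2) / 2)"] conjI always_eventually allI DERIV_energy_along[OF adm])
qed

lemma critical: "critical_point g r0 (\<lambda>_. 0) (\<lambda>_. 0)"
proof -
  have "admissible (\<lambda>_. 0) (\<lambda>_. 0)"
    using smooth_on_0_pi_sinusoid[of 0] by (auto simp: admissible_def intro!: Dpi_eqI)
  then show ?thesis
    using has_integral_integrable[OF density_has_integral] DERIV_energy_along[where e = 0]
    by (auto simp: critical_point_def simp del: add_0)
qed

section \<open>Both signs of the second variation\<close>

text \<open>At w = 0 \<open>alpha\<close> becomes R S and \<open>L\<close> the square of S, which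
  leaves a quadratic form in x, z and the derivative of x.\<close>

lemma Psi_0:
  "Psi x z 0 t = P x z t / (R t * S t) - C t * ((x t)\<^sup>2 * (S t)\<^sup>2 + (R t)\<^sup>2 * (z t)\<^sup>2) / (2 * R t * S t)
     + (z t)\<^sup>2 * sqrt ((S t)\<^sup>2 - (k t)\<^sup>2) / (2 * (S t)\<^sup>2)"
  using S_pos[of t] R_pos[of t] by (simp add: Psi_def alpha'_def alpha_def L_def real_sqrt_mult)

lemma Psi_0_continuous:
  assumes "admissible x z"
  shows "continuous_on {0..pi} (Psi x z 0)"
  by (rule continuous_on_compose2[OF continuous_on_Psi[OF admissible_cont(1-4)[OF assms]],
        of "{0..pi}" "\<lambda>t. (0, t)", simplified]) (auto intro!: continuous_intros)

lemma second_variation_negative: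
  "admissible (\<lambda>_. 1) (\<lambda>_. 0)" "integral {0..pi} (Psi (\<lambda>_. 1) (\<lambda>_. 0) 0) < 0"
proof -
  show adm: "admissible (\<lambda>_. 1) (\<lambda>_. 0)"
    using smooth_on_0_pi_sinusoid[of 0] smooth_on_0_pi_sinusoid[of 1 0 "pi / 2"]
    by (auto simp: admissible_def intro!: Dpi_eqI)
  have "Psi (\<lambda>_. 1) (\<lambda>_. 0) 0 t < 0" if "t \<in> {0<..<pi}" for t
    using that p_pos[OF that] h_pos[of t] S_pos[of t] R_pos[of t] sin_gt_zero[of t]
    by (simp add: Psi_0 P_def C_def)
  then have "integral {0..pi} (Psi (\<lambda>_. 1) (\<lambda>_. 0) 0) < integral {0..pi} (\<lambda>_. 0)"
    using Psi_0_continuous[OF adm] by (intro integral_less_real) (auto simp: pi_gt_zero not_le)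
  then show "integral {0..pi} (Psi (\<lambda>_. 1) (\<lambda>_. 0) 0) < 0" by simp
qed

lemma second_variation_positive:
  "\<exists>x z. admissible x z \<and> 0 < integral {0..pi} (Psi x z 0)"
proof -
  note [continuous_intros] = S'_cont R'_cont p_cont
  have nz: "h t \<noteq> 0" "S t \<noteq> 0" "R t \<noteq> 0" for t
    using h_pos[of t] S_pos[of t] R_pos[of t] by auto
  \<comment> \<open>\<open>q\<close> times sin is the coefficient of the cross term; by compactness
    it has a positive minimum \<open>q0\<close>.\<close>
  define q where "q t = sqrt (h t) / (R t * S t)" for t
  have q_cont [continuous_intros]: "continuous_on {0..pi} q"
    unfolding q_def[abs_def] using nz by (intro continuous_intros) auto
  have "\<exists>t0\<in>{0..pi}. \<forall>t\<in>{0..pi}. q t0 \<le> q t"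
    by (intro continuous_attains_inf q_cont) auto
  then obtain q0 where q0: "q0 > 0" "\<And>t. t \<in> {0..pi} \<Longrightarrow> q0 \<le> q t"
    using h_pos S_pos R_pos unfolding q_def by (metis divide_pos_pos mult_pos_pos real_sqrt_gt_zero)
  \<comment> \<open>Bounds the other terms that can be negative, uniformly in the frequency, since
    x, z and sin have modulus at most 1.\<close>
  define M where "M t = \<bar>q t * R' t / R t\<bar> + \<bar>C t * (S t)\<^sup>2 / (2 * R t * S t)\<bar> + \<bar>C t * (R t)\<^sup>2 / (2 * R t * S t)\<bar>" for t
  have "continuous_on {0..pi} M"
    unfolding M_def[abs_def] C_def using nz by (intro continuous_intros) auto
  then have "\<exists>t0\<in>{0..pi}. \<forall>t\<in>{0..pi}. M t \<le> M t0"
    by (intro continuous_attains_sup) auto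
  then obtain M0 where M0: "\<And>t. t \<in> {0..pi} \<Longrightarrow> M t \<le> M0" by blast
  \<comment> \<open>The cross term contributes at least n q0 to the integral, the rest at least - pi
    M0.\<close>
  obtain n :: nat where n: "pi * M0 / q0 < real n" "0 < n"
    using reals_Archimedean2[of "max 0 (pi * M0 / q0)"] by auto
  \<comment> \<open>The sign makes the cross term n times a square. Since n is an integer, sin(n t)
    vanishes at both poles, which gives the boundary conditions for x and for z.\<close>
  define x z where "x t = - cos (real n * t)" and "z t = sin (real n * t)" for t
  have Dx: "Dpi x t = real n * sin (real n * t)" if "t \<in> {0..pi}" for t
    unfolding x_def[abs_def] using that by (intro Dpi_eqI) (auto intro!: derivative_eq_intros)
  have adm: "admissible x z"
    using smooth_on_0_pi_sinusoid[of "-1" "real n" "pi / 2"] smooth_on_0_pi_sinusoid[of 1 "real n" 0]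
    by (auto simp: admissible_def Dx) (auto simp: x_def[abs_def] z_def[abs_def] sin_add)
  have lower: "real n * q0 * (sin t * (sin (real n * t))\<^sup>2) - M0 \<le> Psi x z 0 t"
    if t: "t \<in> {0..pi}" for t
  proof -
    have s: "0 \<le> sin t" "sin t \<le> 1" using t by (auto intro: sin_ge_zero)
    have le1: "\<bar>x t\<bar> \<le> 1" "\<bar>z t\<bar> \<le> 1" by (auto simp: x_def z_def abs_cos_le_one abs_sin_le_one)
    have x2: "(x t)\<^sup>2 \<le> 1" "(z t)\<^sup>2 \<le> 1" using le1 by (simp_all add: abs_square_le_1)
    have "\<bar>sin t * x t * z t\<bar> \<le> 1 * 1 * 1" unfolding abs_mult
      using s le1 by (intro mult_mono) auto
    then have "\<bar>q t * R' t / R t\<bar> * \<bar>sin t * x t * z t\<bar> \<le> \<bar>q t * R' t / R t\<bar> * 1"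
      by (intro mult_left_mono) auto
    then have 1: "q t * R' t / R t * (sin t * x t * z t) \<le> \<bar>q t * R' t / R t\<bar>"
      unfolding abs_mult[symmetric] by linarith
    have bd: "y * c \<le> \<bar>y\<bar>" if "0 \<le> c" "c \<le> 1" for y c :: real
      using order_trans[OF mult_right_mono[OF abs_ge_self] mult_left_mono[OF that(2) abs_ge_zero]] that(1)
      by simp
    have 2: "C t * (S t)\<^sup>2 / (2 * R t * S t) * (x t)\<^sup>2 \<le> \<bar>C t * (S t)\<^sup>2 / (2 * R t * S t)\<bar>"
      "C t * (R t)\<^sup>2 / (2 * R t * S t) * (z t)\<^sup>2 \<le> \<bar>C t * (R t)\<^sup>2 / (2 * R t * S t)\<bar>"
      by (intro bd zero_le_power2 x2)+
    have 3: "0 \<le> (z t)\<^sup>2 * sqrt ((S t)\<^sup>2 - (k t)\<^sup>2) / (2 * (S t)\<^sup>2)"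
      using k_le[OF t] by auto
    have 4: "q0 * (real n * (sin t * (z t)\<^sup>2)) \<le> q t * (real n * (sin t * (z t)\<^sup>2))"
      using s by (intro mult_right_mono q0(2) t) auto
    have "Psi x z 0 t = q t * (real n * (sin t * (z t)\<^sup>2)) - q t * R' t / R t * (sin t * x t * z t)
       - C t * (S t)\<^sup>2 / (2 * R t * S t) * (x t)\<^sup>2 - C t * (R t)\<^sup>2 / (2 * R t * S t) * (z t)\<^sup>2
       + (z t)\<^sup>2 * sqrt ((S t)\<^sup>2 - (k t)\<^sup>2) / (2 * (S t)\<^sup>2)"
      using nz[of t] by (simp add: Psi_0 P_def Dx[OF t] q_def z_def[symmetric])
        (simp add: field_simps power2_eq_square)
    moreover have "sin (real n * t) = z t" by (simp add: z_def)
    ultimately show ?thesis using 1 2 3 4 M0[OF t] by (simp only: M_def) argo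
  qed
  have "real n * q0 * 1 - pi * M0
      \<le> real n * q0 * integral {0..pi} (\<lambda>t. sin t * (sin (real n * t))\<^sup>2) - pi * M0"
    using q0 n integral_sin_mult_sin_power2_ge[OF n(2)]
    by (intro diff_right_mono mult_left_mono) auto
  also have "\<dots> = integral {0..pi} (\<lambda>t. real n * q0 * (sin t * (sin (real n * t))\<^sup>2) - M0)"
    by (subst integral_diff) (auto intro!: integrable_continuous_real continuous_intros)
  also have "\<dots> \<le> integral {0..pi} (Psi x z 0)"
    by (intro integral_le lower integrable_continuous_real Psi_0_continuous[OF adm])
      (auto intro!: continuous_intros)
  finally show ?thesis using adm n q0 by (intro exI[of _ x] exI[of _ z]) (auto simp: field_simps)
qed

theorem saddle: "saddle_point g r0 (\<lambda>_. 0) (\<lambda>_. 0)"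
  unfolding saddle_point_def
  using critical second_variation second_variation_negative second_variation_positive
  by (meson half_gt_zero divide_neg_pos zero_less_numeral)

end

section \<open>The Schwarzschild and Kerr spheres\<close>

theorem corollary3p1:
  fixes a m r0 :: real
  assumes "0 \<le> a" and "a \<le> m" and "0 < m" and "m \<le> r0"
    and "0 < kerr_Delta a m r0"
    and "0 < a \<Longrightarrow> \<forall>\<theta>\<in>{0<..<pi}. 0 < beta_radicand (kerr a m) r0 (\<lambda>_. 0) \<theta>"
  shows "saddle_point (kerr a m) r0 (\<lambda>_. 0) (\<lambda>_. 0)"
proof -
  define D where "D = kerr_Delta a m r0"
  define \<sigma> where "\<sigma> t = r0\<^sup>2 + a\<^sup>2 * (cos t)\<^sup>2" for t
  \<comment> \<open>Chosen so that \<open>(r0\<^sup>2 + a\<^sup>2)\<^sup>2 - D * a\<^sup>2 * (sin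
    t)\<^sup>2 = D * \<sigma> t + \<kappa>\<close>, which makes \<open>h\<close> visibly
    positive.\<close>
  define \<kappa> where "\<kappa> = 2 * m * r0 * (r0\<^sup>2 + a\<^sup>2)"
  define h where "h t = D + \<kappa> / \<sigma> t" for t
  define h' where "h' t = 2 * a\<^sup>2 * \<kappa> * sin t * cos t / (\<sigma> t)\<^sup>2" for t
  define h'' where "h'' t = 2 * a\<^sup>2 * \<kappa> * ((cos t)\<^sup>2 - (sin t)\<^sup>2) / (\<sigma> t)\<^sup>2
     + 8 * a ^ 4 * \<kappa> * (sin t)\<^sup>2 * (cos t)\<^sup>2 / (\<sigma> t) ^ 3" for t
  define S' where "S' t = - a\<^sup>2 * sin t * cos t / kerr_Sigma a r0 t" for t
  define p where "p t = 4 * r0 * (r0\<^sup>2 + a\<^sup>2) - (2 * r0 - 2 * m) * a\<^sup>2 * (sin t)\<^sup>2" for t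
  have r0: "0 < r0" and D: "0 < D" and \<kappa>: "0 < \<kappa>"
    using assms by (auto simp: D_def \<kappa>_def add_pos_nonneg)
  have \<sigma>: "0 < \<sigma> t" for t using r0 by (simp add: \<sigma>_def add_pos_nonneg)
  have S2: "(kerr_Sigma a r0 t)\<^sup>2 = \<sigma> t" and S: "0 < kerr_Sigma a r0 t" for t
    using \<sigma>[of t] by (simp_all add: kerr_Sigma_def \<sigma>_def)
  have d\<sigma>: "(\<sigma> has_real_derivative - 2 * a\<^sup>2 * sin t * cos t) (at t)" for t
    unfolding \<sigma>_def[abs_def] by (auto intro!: derivative_eq_intros)
  have mH: "mH (kerr a m) r0 t = (sin t)\<^sup>2 * h t" for t
  proof -
    have "(r0\<^sup>2 + a\<^sup>2)\<^sup>2 - D * a\<^sup>2 * (sin t)\<^sup>2 = D * \<sigma> t + \<kappa>"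
      unfolding \<kappa>_def \<sigma>_def D_def kerr_Delta_def sin_squared_eq
      by (simp add: algebra_simps power2_eq_square)
    then show ?thesis using \<sigma>[of t]
      by (simp add: kerr_def S2 D_def[symmetric] h_def field_simps)
  qed
  have radicand: "0 < beta_radicand (kerr a m) r0 (\<lambda>_. 0) t" if t: "t \<in> {0<..<pi}" for t
  proof (cases "a = 0")
    case False
    then show ?thesis using assms t by auto
  next
    \<comment> \<open>For a = 0 the sphere is round and the radicand equals
      \<open>4 * r0 ^ 4 * (sin t) ^ 4\<close>.\<close>
    case True
    have h: "h u = r0\<^sup>2" for u
      using r0 True by (simp add: h_def \<kappa>_def D_def kerr_Delta_def \<sigma>_def power2_eq_square)
    have "dtheta (mH (kerr a m)) r0 t = 2 * sin t * cos t * r0\<^sup>2"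
      unfolding dtheta_def mH h by (rule DERIV_imp_deriv) (auto intro!: derivative_eq_intros)
    then have "beta_radicand (kerr a m) r0 (\<lambda>_. 0) t = (2 * (sin t)\<^sup>2 * r0\<^sup>2)\<^sup>2"
      using True by (simp add: beta_radicand_def mH h ell_def kerr_def kerr_Sigma_def power_mult_distrib cos_squared_eq)
        (simp add: algebra_simps power2_eq_square power4_eq_xxxx)
    then show ?thesis using r0 sin_gt_zero[of t] t by simp
  qed
  have p: "0 < p t" for t
  proof -
    have "(2 * r0 - 2 * m) * a\<^sup>2 * (sin t)\<^sup>2 \<le> (2 * r0) * a\<^sup>2 * 1"
      using assms by (intro mult_mono) (auto simp: abs_square_le_1)
    also have "\<dots> < 4 * r0 * (r0\<^sup>2 + a\<^sup>2)"
      using r0 by (simp add: algebra_simps add_nonneg_pos)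
    finally show ?thesis by (simp add: p_def)
  qed
  have radial: "deriv (\<lambda>r. mH (kerr a m) r t * (mS (kerr a m) r t)\<^sup>2) r0 = (sin t)\<^sup>2 * p t" for t
  proof (rule DERIV_imp_deriv)
    have "((\<lambda>r. (sin t)\<^sup>2 * ((r\<^sup>2 + a\<^sup>2)\<^sup>2 - kerr_Delta a m r * a\<^sup>2 * (sin t)\<^sup>2)) has_real_derivative
        (sin t)\<^sup>2 * p t) (at r0)"
      unfolding kerr_Delta_def p_def
      by (auto intro!: derivative_eq_intros simp: algebra_simps power2_eq_square)
    \<comment> \<open>The closed form requires cancelling the square of \<Sigma>, which is nonzero
      for r > 0; a neighbourhood of r0 suffices.\<close>
    moreover have "\<forall>\<^sub>F r in nhds r0. (sin t)\<^sup>2 * ((r\<^sup>2 + a\<^sup>2)\<^sup>2 - kerr_Delta a m r * a\<^sup>2 * (sin t)\<^sup>2)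
        = mH (kerr a m) r t * (mS (kerr a m) r t)\<^sup>2"
      using eventually_nhds_in_open[of "{0<..}" r0] r0
      by (auto elim!: eventually_mono simp: kerr_def kerr_Sigma_def add_pos_nonneg less_imp_neq[symmetric])
    ultimately show "((\<lambda>r. mH (kerr a m) r t * (mS (kerr a m) r t)\<^sup>2) has_real_derivative (sin t)\<^sup>2 * p t) (at r0)"
      by (subst DERIV_cong_ev[OF refl _ refl, symmetric])
  qed
  have dS: "(kerr_Sigma a r0 has_real_derivative S' t) (at t)" for t
    unfolding kerr_Sigma_def[abs_def] S'_def \<sigma>_def[symmetric]
    using \<sigma>[of t] by (auto intro!: derivative_eq_intros d\<sigma> simp: divide_simps)
  interpret embeddable_sphere "kerr a m" r0 h h' h'' "kerr_Sigma a r0" S'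
    "\<lambda>t. kerr_Sigma a r0 t / sqrt D" "\<lambda>t. S' t / sqrt D" p
  proof
    fix t
    show "(h has_real_derivative h' t) (at t)"
      unfolding h_def[abs_def] h'_def using \<sigma>[of t]
      by (auto intro!: derivative_eq_intros d\<sigma> simp: power2_eq_square)
    show "(h' has_real_derivative h'' t) (at t)"
      unfolding h'_def[abs_def] h''_def using \<sigma>[of t]
      by (auto intro!: derivative_eq_intros d\<sigma>) (simp add: field_simps power2_eq_square power3_eq_cube power4_eq_xxxx)
    show "0 < h t" using D \<kappa> \<sigma>[of t] by (simp add: h_def add_pos_pos)
    show "((\<lambda>t. kerr_Sigma a r0 t / sqrt D) has_real_derivative S' t / sqrt D) (at t)"
      by (intro DERIV_cdivide dS)
    have "continuous_on {0..pi} (kerr_Sigma a r0)"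
      using dS by (auto intro!: continuous_at_imp_continuous_on DERIV_isCont)
    then show "continuous_on {0..pi} S'"
      unfolding S'_def[abs_def] using S by (intro continuous_intros) (auto simp: less_imp_neq[symmetric])
    then show "continuous_on {0..pi} (\<lambda>t. S' t / sqrt D)"
      using D by (intro continuous_intros) auto
    show "continuous_on {0..pi} p" unfolding p_def[abs_def] by (intro continuous_intros)
  next
    \<comment> \<open>At the poles \<sigma> is \<open>r0\<^sup>2 + a\<^sup>2\<close>, so
      \<kappa>/\<sigma> is \<open>2 * m * r0\<close>, exactly what \<open>D\<close> lacks.\<close>
    have "h t = \<sigma> t" if "(cos t)\<^sup>2 = 1" for t
    proof -
      have "\<sigma> t = r0\<^sup>2 + a\<^sup>2" using that by (simp add: \<sigma>_def)
      then show ?thesis using \<sigma>[of t] by (simp add: h_def \<kappa>_def D_def kerr_Delta_def)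
    qed
    then show "h 0 = (kerr_Sigma a r0 0)\<^sup>2" "h pi = (kerr_Sigma a r0 pi)\<^sup>2"
      by (simp_all add: S2)
  qed (use D S p mH radicand radial dS in \<open>auto simp: kerr_def D_def\<close>)
  show ?thesis by (rule saddle)
qed

end
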